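(* Let $N, M \ge 1$ be integers and let $\mathbf{y}_1,\dots,\mathbf{y}_M \in \mathbb{C}^N$ be vectors, not all zero, such that $\{\mathbf{y}_1,\dots,\mathbf{y}_M\}$ is a $B$-tight frame (with $B>0$) for the subspace $W_{0,0} = \operatorname{span}\{\mathbf{y}_1,\dots,\mathbf{y}_M\}$. For $k,\ell \in \{0,\dots,N-1\}$ let $W_{k,\ell} = \operatorname{span}\{T_k M_\ell \mathbf{y}_j\}_{j=1}^M$, and let $P_{k,\ell}$ be the orthogonal projection of $\mathbb{C}^N$ onto $W_{k,\ell}$. Put $\|\mathbf{Y}\|_2^2 := \sum_{j=1}^M \|\mathbf{y}_j\|^2$. Then $\{W_{k,\ell}\}_{k,\ell=0}^{N-1}$ is a $\frac{N\|\mathbf{Y}\|_2^2}{B}$-tight fusion frame for $\mathbb{C}^N$; that is, for every $\mathbf{x} \in \mathbb{C}^N$, $$\sum_{k,\ell=0}^{N-1} \|P_{k,\ell}\mathbf{x}\|^2 = \frac{N\|\mathbf{Y}\|_2^2}{B}\,\|\mathbf{x}\|_2^2 .$$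
   Context: $\mathbb{C}^N$ carries its standard inner product and norm, and coordinates of $\mathbf{x} \in \mathbb{C}^N$ are indexed by $n \in \{0,1,\dots,N-1\}$, identified with $\mathbb{Z}_N$. The translation operator is $(T_k\mathbf{x})(n) = \mathbf{x}(n-k)$ with $n-k$ taken modulo $N$; the modulation operator is $(M_\ell \mathbf{x})(n) = e^{-2\pi i \ell n/N}\mathbf{x}(n)$. A finite family $\{g_j\}$ in a finite-dimensional inner product space $V$ is a $C$-tight frame for $V$ if $\sum_j |\langle x, g_j\rangle|^2 = C\|x\|^2$ for all $x \in V$. A finite family of subspaces $\{W_i\}$ of $\mathbb{C}^N$ (all with weight $1$), with orthogonal projections $P_i$, is an $A$-tight fusion frame ($A>0$) if $\sum_i \|P_i x\|^2 = A\|x\|^2$ for all $x \in \mathbb{C}^N$. *)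

theory Defs
  imports "HOL-Analysis.Analysis" "Berlekamp_Zassenhaus.Finite_Field"
begin

text \<open>
  \<open>'n mod_ring\<close> is the ring of integers modulo \<open>CARD('n)\<close>, carried by the representatives
  \<open>{0..<CARD('n)}\<close>; so \<open>complex ^ 'n mod_ring\<close> is $N$-dimensional complex space with
  coordinates indexed by the integers modulo $N$, where \<open>N = CARD('n)\<close>. Subtraction of indices
  is subtraction modulo $N$.
  The library's norm on this type is the Euclidean one and \<open>vec.span\<close> is the complex linear
  span; the library's inner product, however, is real-valued, whence \<open>cinner\<close>.
\<close>

definition cinner :: "complex ^ 'i::finite \<Rightarrow> complex ^ 'i \<Rightarrow> complex" where
  "cinner x y = (\<Sum>i\<in>UNIV. x $ i * cnj (y $ i))"

definition translation :: "nat \<Rightarrow> complex ^ 'n::finite mod_ring \<Rightarrow> complex ^ 'n mod_ring" where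
  "translation k x = (\<chi> n. x $ (n - of_int_mod_ring (int k)))"

definition modulation :: "nat \<Rightarrow> complex ^ 'n::finite mod_ring \<Rightarrow> complex ^ 'n mod_ring" where
  "modulation l x =
     (\<chi> n. exp (- (2 * of_real pi * \<i> * of_nat l * of_int (to_int_mod_ring n)
                    / of_nat CARD('n))) * x $ n)"

definition tight_frame ::
    "real \<Rightarrow> (complex ^ 'i::finite) set \<Rightarrow> 'j set \<Rightarrow> ('j \<Rightarrow> complex ^ 'i) \<Rightarrow> bool" where
  "tight_frame C V J g \<longleftrightarrow>
     vec.subspace V \<and> finite J \<and> g ` J \<subseteq> V \<and>
     (\<forall>x\<in>V. (\<Sum>j\<in>J. (cmod (cinner x (g j)))\<^sup>2) = C * (norm x)\<^sup>2)"

definition orth_proj :: "(complex ^ 'i::finite) set \<Rightarrow> complex ^ 'i \<Rightarrow> complex ^ 'i" where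
  "orth_proj W x = (THE p. p \<in> W \<and> (\<forall>w\<in>W. cinner (x - p) w = 0))"

definition tight_fusion_frame ::
    "real \<Rightarrow> 'j set \<Rightarrow> ('j \<Rightarrow> (complex ^ 'i::finite) set) \<Rightarrow> bool" where
  "tight_fusion_frame A J W \<longleftrightarrow>
     A > 0 \<and> finite J \<and> (\<forall>j\<in>J. vec.subspace (W j)) \<and>
     (\<forall>x. (\<Sum>j\<in>J. (norm (orth_proj (W j) x))\<^sup>2) = A * (norm x)\<^sup>2)"

lemma inner_eq_Re_cinner: "inner x y = Re (cinner x y)"
  by (simp add: inner_vec_def cinner_def inner_complex_def)

lemma cinner_scale_right: "cinner x (c *s y) = cnj c * cinner x y"
  by (simp add: cinner_def sum_distrib_left mult_ac)

text \<open>The description in \<open>orth_proj_def\<close> determines a vector for every complex subspace.\<close>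

lemma orth_proj_ex1:
  fixes W :: "(complex ^ 'i::finite) set"
  assumes W: "vec.subspace W"
  shows "\<exists>!p. p \<in> W \<and> (\<forall>w\<in>W. cinner (x - p) w = 0)"
proof -
  have scaleR: "r *\<^sub>R w = complex_of_real r *s w" for r and w :: "complex ^ 'i"
    by (simp add: vec_eq_iff scaleR_conv_of_real[where 'a=complex])
  have sub: "subspace W"
    using W unfolding subspace_def vec.subspace_def by (auto simp: scaleR)
  then have span: "span W = W"
    by (simp add: span_eq_iff)
  obtain p z where p: "p \<in> span W" and z: "\<And>w. w \<in> span W \<Longrightarrow> orthogonal z w"
    and x: "x = p + z"
    using orthogonal_subspace_decomp_exists[of W x] by metis
  have Re0: "Re (cinner z w) = 0" if "w \<in> W" for w
    using z[of w] that by (simp add: span orthogonal_def inner_eq_Re_cinner)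
  have 0: "cinner z w = 0" if w: "w \<in> W" for w
  proof -
    have "\<i> *s w \<in> W" using W w by (simp add: vec.subspace_def)
    from Re0[OF this] Re0[OF w] show ?thesis
      by (simp add: cinner_scale_right complex_eq_iff)
  qed
  show ?thesis
  proof (rule ex1I)
    show "p \<in> W \<and> (\<forall>w\<in>W. cinner (x - p) w = 0)"
      using p 0 x by (simp add: span)
  next
    fix q assume q: "q \<in> W \<and> (\<forall>w\<in>W. cinner (x - q) w = 0)"
    have d: "q - p \<in> W" using q p sub by (simp add: span subspace_diff)
    have "inner z (q - p) = 0" "inner (x - q) (q - p) = 0"
      using q 0[OF d] d by (simp_all add: inner_eq_Re_cinner)
    then have "inner (q - p) (q - p) = 0"
      by (simp add: x inner_diff_left inner_add_left)
    then show "q = p" by simp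
  qed
qed

end

theory Submission
  imports Defs
begin

text \<open>
  Every \<open>T\<^sub>k M\<^sub>l\<close> is unitary, so the vectors \<open>T\<^sub>k M\<^sub>l y\<^sub>j\<close> form a \<open>B\<close>-tight frame of
  \<open>W\<^sub>k\<^sub>l\<close>; since they lie in \<open>W\<^sub>k\<^sub>l\<close>, they do not distinguish \<open>x\<close> from its projection, and
  \<open>B\<close> times the squared norm of the projection is the sum over \<open>j\<close> of the squared moduli of
  \<open>\<langle>x, T\<^sub>k M\<^sub>l y\<^sub>j\<rangle>\<close>. Summing these over \<open>l\<close> by Parseval's identity for the discrete
  Fourier transform and then over \<open>k\<close> by translation invariance gives
  \<open>N\<close> times the product of the squared norms of \<open>x\<close> and \<open>y\<^sub>j\<close>.
\<close>

lemma cinner_diff_left: "cinner (x - y) z = cinner x z - cinner y z"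
  by (simp add: cinner_def algebra_simps sum_subtractf)

lemma norm_vec_power2: "(norm (x :: complex ^ 'i::finite))\<^sup>2 = (\<Sum>i\<in>UNIV. (cmod (x $ i))\<^sup>2)"
  by (simp add: norm_vec_def L2_set_def sum_nonneg)

lemma cinner_eq_norm_power2: "cinner x x = of_real ((norm x)\<^sup>2)"
  by (simp only: cinner_def norm_vec_power2 of_real_sum complex_norm_square)

lemma orth_proj:
  assumes "vec.subspace W"
  shows orth_proj_in: "orth_proj W x \<in> W"
    and cinner_orth_proj: "w \<in> W \<Longrightarrow> cinner (orth_proj W x) w = cinner x w"
proof -
  have "orth_proj W x \<in> W \<and> (\<forall>w\<in>W. cinner (x - orth_proj W x) w = 0)"
    unfolding orth_proj_def by (rule theI'[OF orth_proj_ex1[OF assms]])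
  then show "orth_proj W x \<in> W" "w \<in> W \<Longrightarrow> cinner (orth_proj W x) w = cinner x w"
    by (simp_all add: cinner_diff_left)
qed

text \<open>The frame identity is available only on \<open>V\<close>. Applying it to the projection,
  which has the same inner products with every \<open>g j\<close>, extends it to arbitrary
  \<open>x\<close>.\<close>

lemma tight_frame_orth_proj:
  assumes "tight_frame B V J g"
  shows "(\<Sum>j\<in>J. (cmod (cinner x (g j)))\<^sup>2) = B * (norm (orth_proj V x))\<^sup>2"
proof -
  have V: "vec.subspace V" and g: "\<And>j. j \<in> J \<Longrightarrow> g j \<in> V"
    using assms by (auto simp: tight_frame_def)
  have "(\<Sum>j\<in>J. (cmod (cinner x (g j)))\<^sup>2) = (\<Sum>j\<in>J. (cmod (cinner (orth_proj V x) (g j)))\<^sup>2)"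
    by (rule sum.cong) (simp_all add: cinner_orth_proj[OF V] g)
  with orth_proj_in[OF V] assms show ?thesis
    by (simp add: tight_frame_def)
qed

text \<open>By linearity, \<open>U\<close> maps the old span onto the new one, so only vectors
  \<open>U v\<close> with \<open>v\<close> in the old span need checking; there \<open>U\<close>
  changes neither side of the identity.\<close>

lemma tight_frame_isometric_image:
  assumes frame: "tight_frame B (vec.span (g ` J)) J g"
    and U: "Vector_Spaces.linear (*s) (*s) U"
    and isom: "\<And>v w. cinner (U v) (U w) = cinner v w"
  shows "tight_frame B (vec.span ((\<lambda>j. U (g j)) ` J)) J (\<lambda>j. U (g j))"
proof -
  have norm: "(norm (U v))\<^sup>2 = (norm v)\<^sup>2" for v
    using isom[of v v] by (simp only: cinner_eq_norm_power2 of_real_eq_iff)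
  have "vec.span ((\<lambda>j. U (g j)) ` J) = U ` vec.span (g ` J)"
    using vec.linear_span_image[OF U, of "g ` J"] by (simp add: image_image)
  with frame show ?thesis
    by (auto simp: tight_frame_def isom norm vec.span_base vec.linear_subspace_image[OF U])
qed

lemma sum_power_root_of_unity:
  fixes z :: "'a::field"
  assumes "z ^ N = 1"
  shows "(\<Sum>l<N. z ^ l) = (if z = 1 then of_nat N else 0)"
  using assms by (simp add: sum_gp_strict)

text \<open>For distinct \<open>m\<close> the sequences \<open>\<omega> m ^ l\<close>,
  \<open>l < N\<close>, are orthogonal with squared norm \<open>N\<close>, so expanding the square
  leaves only the diagonal. An abstract index set lets \<open>A\<close> be \<open>UNIV\<close> of
  \<open>'n mod_ring\<close> later.\<close>

lemma Parseval_roots_of_unity: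
  fixes \<omega> f :: "'a \<Rightarrow> complex"
  assumes "finite A" "N > 0" "inj_on \<omega> A" and root: "\<And>m. m \<in> A \<Longrightarrow> \<omega> m ^ N = 1"
  shows "(\<Sum>l<N. (cmod (\<Sum>m\<in>A. f m * \<omega> m ^ l))\<^sup>2) = real N * (\<Sum>m\<in>A. (cmod (f m))\<^sup>2)"
proof -
  have orth: "(\<Sum>l<N. \<omega> m ^ l * cnj (\<omega> m') ^ l) = (if m = m' then of_nat N else 0)"
    if m: "m \<in> A" "m' \<in> A" for m m'
  proof -
    \<comment> \<open>Modulus 1 makes \<open>cnj (\<omega> m')\<close> the inverse of
      \<open>\<omega> m'\<close>; the summand is then a power of the ratio of two roots, which is 1
      only for equal roots.\<close>
    have "cmod (\<omega> m') = 1"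
      by (rule power_eq_imp_eq_base[OF _ norm_ge_zero zero_le_one \<open>N > 0\<close>])
        (simp flip: norm_power add: root[OF m(2)])
    then have cnj: "cnj (\<omega> m') * \<omega> m' = 1"
      using complex_norm_square[of "\<omega> m'"] by (simp add: mult.commute)
    have "\<omega> m * cnj (\<omega> m') = 1 \<longleftrightarrow> m = m'"
    proof
      assume "\<omega> m * cnj (\<omega> m') = 1"
      then have "\<omega> m = \<omega> m'"
        using mult.assoc[of "\<omega> m" "cnj (\<omega> m')" "\<omega> m'"] cnj by simp
      then show "m = m'" using inj_onD[OF \<open>inj_on \<omega> A\<close>] m by blast
    qed (use cnj in \<open>simp add: mult.commute\<close>)
    moreover have "(\<omega> m * cnj (\<omega> m')) ^ N = 1"
      using root[OF m(1)] root[OF m(2)] by (simp add: power_mult_distrib flip: complex_cnj_power)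
    ultimately show ?thesis
      using sum_power_root_of_unity[of "\<omega> m * cnj (\<omega> m')" N] by (simp add: power_mult_distrib)
  qed
  have "complex_of_real (\<Sum>l<N. (cmod (\<Sum>m\<in>A. f m * \<omega> m ^ l))\<^sup>2)
      = (\<Sum>l<N. (\<Sum>m\<in>A. f m * \<omega> m ^ l) * (\<Sum>m'\<in>A. cnj (f m') * cnj (\<omega> m') ^ l))"
    by (simp only: of_real_sum complex_norm_square cnj_sum complex_cnj_mult complex_cnj_power)
  also have "\<dots> = (\<Sum>l<N. \<Sum>m\<in>A. \<Sum>m'\<in>A. f m * cnj (f m') * (\<omega> m ^ l * cnj (\<omega> m') ^ l))"
    by (simp add: sum_product mult_ac)
  also have "\<dots> = (\<Sum>m\<in>A. \<Sum>m'\<in>A. f m * cnj (f m') * (\<Sum>l<N. \<omega> m ^ l * cnj (\<omega> m') ^ l))"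
    by (simp only: sum_distrib_left) (subst sum.swap, intro sum.cong refl sum.swap)
  also have "\<dots> = (\<Sum>m\<in>A. \<Sum>m'\<in>A. if m = m' then f m * cnj (f m') * of_nat N else 0)"
    by (intro sum.cong refl) (simp add: orth)
  also have "\<dots> = (\<Sum>m\<in>A. of_nat N * (f m * cnj (f m)))"
    using \<open>finite A\<close> by (simp add: mult_ac)
  also have "\<dots> = of_real (real N * (\<Sum>m\<in>A. (cmod (f m))\<^sup>2))"
    by (simp only: of_real_sum of_real_mult complex_norm_square of_real_of_nat_eq sum_distrib_left)
  finally show ?thesis
    by (simp only: of_real_eq_iff)
qed

text \<open>The exponent is opposite in sign to that of \<open>modulation\<close>: the conjugate in
  the second argument of \<open>cinner\<close> turns the modulation phase into a power of this
  root.\<close>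

definition root_of_unity :: "'n::finite mod_ring \<Rightarrow> complex" where
  "root_of_unity n = exp (2 * of_real pi * \<i> * of_nat (nat (to_int_mod_ring n)) / of_nat CARD('n))"

lemma to_int_mod_ring_bounds:
  "0 \<le> to_int_mod_ring n" "to_int_mod_ring (n :: 'n::finite mod_ring) < int CARD('n)"
  using range_to_int_mod_ring[where 'a='n] by (auto simp: set_eq_iff)

lemma root_of_unity_power: "root_of_unity (n :: 'n::finite mod_ring) ^ CARD('n) = 1"
  unfolding root_of_unity_def by (rule complex_root_unity) simp

lemma inj_root_of_unity: "inj (root_of_unity :: 'n::finite mod_ring \<Rightarrow> complex)"
proof (rule injI)
  fix m n :: "'n mod_ring"
  assume "root_of_unity m = root_of_unity n"
  then have "nat (to_int_mod_ring m) mod CARD('n) = nat (to_int_mod_ring n) mod CARD('n)"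
    by (simp add: root_of_unity_def complex_root_unity_eq cong_def)
  then have "nat (to_int_mod_ring m) = nat (to_int_mod_ring n)"
    \<comment> \<open>Representatives lie below \<open>CARD('n)\<close>, so reduction leaves them
      unchanged.\<close>
    using to_int_mod_ring_bounds[of m] to_int_mod_ring_bounds[of n] by (simp add: nat_less_iff)
  then have "to_int_mod_ring m = to_int_mod_ring n"
    by (simp only: eq_nat_nat_iff to_int_mod_ring_bounds(1))
  then show "m = n"
    by (metis of_int_mod_ring_to_int_mod_ring)
qed

lemma modulation_nth: "modulation l x $ n = cnj (root_of_unity n ^ l) * x $ n"
  using to_int_mod_ring_bounds(1)[of n]
  by (simp add: modulation_def root_of_unity_def exp_cnj mult_ac flip: exp_of_nat_mult)

lemma cmod_root_of_unity: "cmod (root_of_unity n) = 1"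
  by (simp add: root_of_unity_def)

lemma sum_shift_mod_ring:
  "(\<Sum>n\<in>UNIV. f (n - k)) = (\<Sum>n\<in>UNIV. f n)" for k :: "'n::finite mod_ring"
  by (rule sum.reindex_bij_witness[of _ "\<lambda>n. n + k" "\<lambda>n. n - k"]) auto

lemma linear_translation_modulation:
  "Vector_Spaces.linear (*s) (*s) (\<lambda>x. translation k (modulation l x))"
  by unfold_locales (simp_all add: vec_eq_iff translation_def modulation_def algebra_simps)

text \<open>Modulation multiplies coordinates by numbers of modulus 1, and translation permutes
  them.\<close>

lemma cinner_translation_modulation:
  "cinner (translation k (modulation l x)) (translation k (modulation l y)) = cinner x y"
proof -
  have "root_of_unity n * cnj (root_of_unity n) = 1" for n :: "'a mod_ring"
    using complex_norm_square[of "root_of_unity n"] by (simp add: cmod_root_of_unity)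
  then have "cnj (root_of_unity n) ^ l * root_of_unity n ^ l = 1" for n :: "'a mod_ring"
    by (simp add: mult.commute flip: power_mult_distrib)
  then have "cnj (root_of_unity n) ^ l * (root_of_unity n ^ l * c) = c" for n :: "'a mod_ring" and c
    by (metis mult.assoc mult_1)
  then have "modulation l x $ n * cnj (modulation l y $ n) = x $ n * cnj (y $ n)" for n
    by (simp add: modulation_nth mult_ac)
  then show ?thesis
    by (simp add: cinner_def translation_def sum_shift_mod_ring[of "\<lambda>n. x $ n * cnj (y $ n)"])
qed

lemma sum_cmod_cinner_translation_modulation:
  fixes x y :: "complex ^ 'n::finite mod_ring"
  shows "(\<Sum>k<CARD('n). \<Sum>l<CARD('n). (cmod (cinner x (translation k (modulation l y))))\<^sup>2)
    = real CARD('n) * (norm x)\<^sup>2 * (norm y)\<^sup>2"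
proof -
  let ?N = "CARD('n)"
  let ?k = "\<lambda>k. of_int_mod_ring (int k) :: 'n mod_ring"
  \<comment> \<open>Substituting \<open>n = m + ?k k\<close> moves the shift onto \<open>x\<close>.
    For fixed \<open>k\<close> these are, as \<open>l\<close> varies, Fourier coefficients of a
    pointwise product.\<close>
  have coeff: "cinner x (translation k (modulation l y))
      = (\<Sum>m\<in>UNIV. x $ (m + ?k k) * cnj (y $ m) * root_of_unity m ^ l)" for k l
    unfolding cinner_def translation_def
    by (rule sum.reindex_bij_witness[of _ "\<lambda>n. n + ?k k" "\<lambda>n. n - ?k k"])
      (auto simp: modulation_nth)
  \<comment> \<open>As \<open>k\<close> runs below \<open>?N\<close>, \<open>m + ?k k\<close> meets
    each residue once; the inverse sends \<open>n\<close> to the representative of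
    \<open>n - m\<close>.\<close>
  have shift: "(\<Sum>k<?N. f (m + ?k k)) = (\<Sum>n\<in>UNIV. f n)"
    for f :: "'n mod_ring \<Rightarrow> real" and m
  proof (rule sum.reindex_bij_witness[of _ "\<lambda>n. nat (to_int_mod_ring (n - m))" "\<lambda>k. m + ?k k"])
    fix n :: "'n mod_ring"
    show "nat (to_int_mod_ring (n - m)) \<in> {..<?N}"
      using to_int_mod_ring_bounds[of "n - m"] by (simp add: nat_less_iff)
    show "m + ?k (nat (to_int_mod_ring (n - m))) = n"
      using to_int_mod_ring_bounds(1)[of "n - m"] by simp
  qed auto
  have "(\<Sum>k<?N. \<Sum>l<?N. (cmod (cinner x (translation k (modulation l y))))\<^sup>2)
      = (\<Sum>k<?N. real ?N * (\<Sum>m\<in>UNIV. (cmod (x $ (m + ?k k)))\<^sup>2 * (cmod (y $ m))\<^sup>2))"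
    unfolding coeff
    by (subst Parseval_roots_of_unity)
      (auto simp: inj_root_of_unity root_of_unity_power norm_mult power_mult_distrib)
  \<comment> \<open>With \<open>k\<close> innermost, \<open>shift\<close> makes the inner sum the
    squared norm of \<open>x\<close> for every \<open>m\<close>.\<close>
  also have "\<dots> = real ?N * (\<Sum>m\<in>UNIV. (cmod (y $ m))\<^sup>2 * (\<Sum>k<?N. (cmod (x $ (m + ?k k)))\<^sup>2))"
    by (simp only: sum_distrib_left, subst sum.swap) (simp only: mult_ac)
  also have "\<dots> = real ?N * (norm x)\<^sup>2 * (norm y)\<^sup>2"
    by (simp add: shift[of "\<lambda>n. (cmod (x $ n))\<^sup>2"] norm_vec_power2 flip: sum_distrib_right)
  finally show ?thesis .
qed

theorem theorem4p2:
  fixes y :: "nat \<Rightarrow> complex ^ 'n::finite mod_ring"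
    and M :: nat
    and B :: real
    and W :: "nat \<Rightarrow> nat \<Rightarrow> (complex ^ 'n mod_ring) set"
  assumes "M \<ge> 1"
    and "\<exists>j\<in>{1..M}. y j \<noteq> 0"
    and "B > 0"
    and "tight_frame B (vec.span (y ` {1..M})) {1..M} y"
    and "\<And>k l. W k l = vec.span ((\<lambda>j. translation k (modulation l (y j))) ` {1..M})"
  shows "tight_fusion_frame (real CARD('n) * (\<Sum>j=1..M. (norm (y j))\<^sup>2) / B)
           ({0..<CARD('n)} \<times> {0..<CARD('n)}) (\<lambda>(k, l). W k l)
       \<and> (\<forall>x. (\<Sum>k=0..<CARD('n). \<Sum>l=0..<CARD('n). (norm (orth_proj (W k l) x))\<^sup>2)
           = real CARD('n) * (\<Sum>j=1..M. (norm (y j))\<^sup>2) / B * (norm x)\<^sup>2)"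
proof -
  let ?N = "CARD('n)"
  let ?A = "real ?N * (\<Sum>j=1..M. (norm (y j))\<^sup>2) / B"
  have frame: "tight_frame B (W k l) {1..M} (\<lambda>j. translation k (modulation l (y j)))" for k l
    using tight_frame_isometric_image[OF assms(4) linear_translation_modulation
        cinner_translation_modulation] assms(5) by simp
  have sum: "(\<Sum>k=0..<?N. \<Sum>l=0..<?N. (norm (orth_proj (W k l) x))\<^sup>2) = ?A * (norm x)\<^sup>2" for x
  proof -
    \<comment> \<open>The factor \<open>B\<close> turns each squared norm into a frame sum; it is
      divided out at the end.\<close>
    have "B * (\<Sum>k<?N. \<Sum>l<?N. (norm (orth_proj (W k l) x))\<^sup>2)
        = (\<Sum>k<?N. \<Sum>l<?N. \<Sum>j=1..M. (cmod (cinner x (translation k (modulation l (y j)))))\<^sup>2)"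
      by (simp only: tight_frame_orth_proj[OF frame] sum_distrib_left)
    also have "\<dots> = (\<Sum>j=1..M. \<Sum>k<?N. \<Sum>l<?N. (cmod (cinner x (translation k (modulation l (y j)))))\<^sup>2)"
      by (subst (2) sum.swap, subst sum.swap) (intro sum.cong refl sum.swap)
    also have "\<dots> = real ?N * (norm x)\<^sup>2 * (\<Sum>j=1..M. (norm (y j))\<^sup>2)"
      by (simp only: sum_cmod_cinner_translation_modulation sum_distrib_left)
    finally show ?thesis
      using \<open>B > 0\<close> by (simp add: field_simps atLeast0LessThan)
  qed
  \<comment> \<open>A single nonzero \<open>y j\<close> makes the fusion frame constant strictly
    positive.\<close>
  have "(\<Sum>j=1..M. (norm (y j))\<^sup>2) > 0"
    using assms(2) by (auto intro: sum_pos2)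
  then have "?A > 0"
    using \<open>B > 0\<close> by simp
  moreover have "(\<Sum>(k, l)\<in>{0..<?N} \<times> {0..<?N}. (norm (orth_proj (W k l) x))\<^sup>2) = ?A * (norm x)\<^sup>2" for x
    using sum[of x] by (simp only: sum.cartesian_product)
  moreover have "vec.subspace (W k l)" for k l
    by (simp only: assms(5) vec.subspace_span)
  ultimately have "tight_fusion_frame ?A ({0..<?N} \<times> {0..<?N}) (\<lambda>(k, l). W k l)"
    unfolding tight_fusion_frame_def by (simp add: case_prod_unfold)
  with sum show ?thesis
    by blast
qed

end
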